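(* Let $p_s$ be the stationary density on $\mathcal{M}\subseteq\mathbb{R}^d$ of the SDE $dX_t=b(X_t)\,dt+\sigma(X_t)\,dW_t$, let $\Sigma=\sigma\sigma^T$, and suppose that the stationary probability flux vanishes, i.e. $$b(x)p_s(x)=\tfrac12\nabla\cdot\big(\Sigma(x)p_s(x)\big)\quad\text{for all }x\in\mathcal{M}.$$ Let $p(x,t)$ be a function in the domain of $\mathcal{L}^*$ of the form $p(x,t)=f(x,t)\,p_s(x)$. Then $$\mathcal{L}^*p=p_s\,\mathcal{L}f .$$
   Context: $b:\mathbb{R}^d\to\mathbb{R}^d$ is the drift, $\sigma:\mathbb{R}^d\to\mathbb{R}^{d\times s}$ the diffusion function, $W_t$ an $s$-dimensional Wiener process, and $\Sigma(x)=\sigma(x)\sigma^T(x)$ the symmetric diffusion matrix. The infinitesimal generator of the SDE is $$\mathcal{L}v=b\cdot\nabla v+\tfrac12\,\Sigma:\nabla\nabla v,$$ and its formal $L^2$-adjoint (the Fokker–Planck operator) is $$\mathcal{L}^*v=-\nabla\cdot(bv)+\tfrac12\,\nabla\cdot\nabla\cdot(\Sigma v).$$ Here $\nabla\nabla v$ is the Hessian, $A:B=\sum_{i,j}A_{ij}B_{ij}$, the divergence of a matrix field is the vector $(\nabla\cdot(\Sigma v))_i=\sum_j\partial_{x_j}(\Sigma_{ij}v)$, and $\nabla\cdot\nabla\cdot(\Sigma v)=\sum_{i,j}\partial_{x_i}\partial_{x_j}(\Sigma_{ij}v)$. Both operators act in the variable $x$ only. The functions $b,\Sigma,p_s,f$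 are assumed smooth enough (e.g. $f(\cdot,t)$, $\Sigma$ and $p_s$ of class $C^2$ and $b$ of class $C^1$) that all derivatives appearing exist classically. The stationary density $p_s\ge 0$ satisfies $\int_{\mathcal{M}}p_s\,dx=1$ and $\mathcal{L}^*p_s=0$. The process is assumed ergodic and time-reversible (detailed balance), which is what gives the vanishing of the stationary probability flux $b p_s-\tfrac12\nabla\cdot(\Sigma p_s)$. *)

theory Defs
  imports "HOL-Analysis.Analysis"
begin

definition partially_differentiable :: "'d \<Rightarrow> (real^'d \<Rightarrow> real) \<Rightarrow> real^'d \<Rightarrow> bool" where
  "partially_differentiable i v x \<longleftrightarrow> (\<lambda>h::real. v (x + h *\<^sub>R axis i 1)) differentiable (at 0)"

(* Unspecified where the partial derivative does not exist. *)
definition partial :: "'d \<Rightarrow> (real^'d \<Rightarrow> real) \<Rightarrow> real^'d \<Rightarrow> real" where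
  "partial i v x = deriv (\<lambda>h::real. v (x + h *\<^sub>R axis i 1)) 0"

(* C^k on an open set U: all partial derivatives up to order k exist and are continuous on U. *)
fun Ck_on :: "nat \<Rightarrow> (real^'d) set \<Rightarrow> (real^'d \<Rightarrow> real) \<Rightarrow> bool" where
  "Ck_on 0 U v \<longleftrightarrow> continuous_on U v"
| "Ck_on (Suc k) U v \<longleftrightarrow> continuous_on U v \<and>
     (\<forall>i. (\<forall>x\<in>U. partially_differentiable i v x) \<and> Ck_on k U (partial i v))"

definition grad :: "(real^'d \<Rightarrow> real) \<Rightarrow> real^'d \<Rightarrow> real^'d" where
  "grad v x = (\<chi> i. partial i v x)"

definition hessian :: "(real^'d \<Rightarrow> real) \<Rightarrow> real^'d \<Rightarrow> real^'d^'d" where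
  "hessian v x = (\<chi> i j. partial i (partial j v) x)"

definition frobenius :: "real^'d^'d \<Rightarrow> real^'d^'d \<Rightarrow> real" where
  "frobenius A B = (\<Sum>i\<in>UNIV. \<Sum>j\<in>UNIV. A $ i $ j * B $ i $ j)"

definition divergence :: "(real^'d \<Rightarrow> real^'d) \<Rightarrow> real^'d \<Rightarrow> real" where
  "divergence F x = (\<Sum>i\<in>UNIV. partial i (\<lambda>y. F y $ i) x)"

(* Row-wise divergence of a matrix field. *)
definition mat_divergence :: "(real^'d \<Rightarrow> real^'d^'d) \<Rightarrow> real^'d \<Rightarrow> real^'d" where
  "mat_divergence A x = (\<chi> i. \<Sum>j\<in>UNIV. partial j (\<lambda>y. A y $ i $ j) x)"

definition double_divergence :: "(real^'d \<Rightarrow> real^'d^'d) \<Rightarrow> real^'d \<Rightarrow> real" where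
  "double_divergence A x =
     (\<Sum>i\<in>UNIV. \<Sum>j\<in>UNIV. partial i (partial j (\<lambda>y. A y $ i $ j)) x)"

definition diffusion_matrix :: "(real^'d \<Rightarrow> real^'s^'d) \<Rightarrow> real^'d \<Rightarrow> real^'d^'d" where
  "diffusion_matrix \<sigma> x = \<sigma> x ** transpose (\<sigma> x)"

(* The operators of the SDE dX = b(X) dt + sigma(X) dW, given by its coefficients. *)
definition generator ::
  "(real^'d \<Rightarrow> real^'d) \<Rightarrow> (real^'d \<Rightarrow> real^'s^'d) \<Rightarrow> (real^'d \<Rightarrow> real) \<Rightarrow> real^'d \<Rightarrow> real" where
  "generator b \<sigma> v x = b x \<bullet> grad v x + 1/2 * frobenius (diffusion_matrix \<sigma> x) (hessian v x)"

definition fokker_planck ::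
  "(real^'d \<Rightarrow> real^'d) \<Rightarrow> (real^'d \<Rightarrow> real^'s^'d) \<Rightarrow> (real^'d \<Rightarrow> real) \<Rightarrow> real^'d \<Rightarrow> real" where
  "fokker_planck b \<sigma> v x =
     - divergence (\<lambda>y. v y *\<^sub>R b y) x
     + 1/2 * double_divergence (\<lambda>y. v y *\<^sub>R diffusion_matrix \<sigma> y) x"

(* The functions for which every derivative in fokker_planck exists classically throughout U.
   The Fokker-Planck operator is only a formal adjoint, so its domain is read classically,
   not as that of an unbounded operator on a Hilbert space. *)
definition fokker_planck_domain ::
  "(real^'d) set \<Rightarrow> (real^'d \<Rightarrow> real^'d) \<Rightarrow> (real^'d \<Rightarrow> real^'s^'d) \<Rightarrow> (real^'d \<Rightarrow> real) set" where
  "fokker_planck_domain U b \<sigma> = {v. \<forall>x\<in>U. \<forall>i j.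
      partially_differentiable i (\<lambda>y. v y * b y $ i) x \<and>
      partially_differentiable j (\<lambda>y. v y * diffusion_matrix \<sigma> y $ i $ j) x \<and>
      partially_differentiable i (partial j (\<lambda>y. v y * diffusion_matrix \<sigma> y $ i $ j)) x}"

(* The integral being 1 entails integrability, since the Lebesgue integral of a
   non-integrable function is 0 by convention. *)
definition stationary_density ::
  "(real^'d) set \<Rightarrow> (real^'d \<Rightarrow> real^'d) \<Rightarrow> (real^'d \<Rightarrow> real^'s^'d) \<Rightarrow> (real^'d \<Rightarrow> real) \<Rightarrow> bool" where
  "stationary_density M b \<sigma> p\<^sub>s \<longleftrightarrow>
     (\<forall>x\<in>M. 0 \<le> p\<^sub>s x) \<and> (LINT x:M|lebesgue. p\<^sub>s x) = 1 \<and> (\<forall>x\<in>M. fokker_planck b \<sigma> p\<^sub>s x = 0)"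

end

theory Submission
  imports Defs
begin

text \<open>
  Everything rests on a Leibniz rule for the Fokker--Planck operator, lemma \<open>fokker_planck_mult\<close>,
  which holds at each point for all twice continuously differentiable \<open>q\<close> and \<open>u\<close>:
  \<open>L\<^sup>*(u q) = u L\<^sup>* q + q L u - 2 \<nabla>u \<cdot> J(q)\<close>, where \<open>J(q) = q b - 1/2 div(q \<Sigma>)\<close> is the
  probability flux of \<open>q\<close>. The second-order part of \<open>L\<^sup>*(u q)\<close> has two mixed terms,
  in each of which one derivative falls on \<open>u\<close> and one on \<open>q \<Sigma>\<close>; symmetry of
  \<open>\<Sigma> = \<sigma> \<sigma>\<^sup>T\<close> makes them equal, and together they give \<open>\<nabla>u \<cdot> div(q \<Sigma>)\<close>.
  The first-order part gives \<open>- q b \<cdot> \<nabla>u\<close>, whereas \<open>q L u\<close> contains \<open>+ q b \<cdot> \<nabla>u\<close>; the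
  difference \<open>- 2 q b \<cdot> \<nabla>u\<close> and the mixed terms combine to \<open>- 2 \<nabla>u \<cdot> J(q)\<close>.

  For \<open>q = p\<^sub>s\<close> and \<open>u = f(\<cdot>, t)\<close> the first term vanishes by stationarity and the last one by
  the zero-flux hypothesis. Both enter only at the point itself and are never differentiated, which
  is why they may be given on an arbitrary subset \<open>M\<close> of the open set \<open>U\<close> of smoothness.
\<close>

section \<open>Calculus of partial derivatives\<close>

lemma partially_differentiable_has_derivative:
  assumes "partially_differentiable i v x"
  shows "((\<lambda>h. v (x + h *\<^sub>R axis i 1)) has_real_derivative partial i v x) (at 0)"
  using assms unfolding partially_differentiable_def partial_def
  by (simp add: DERIV_deriv_iff_real_differentiable)

lemma partialI:
  assumes "((\<lambda>h. v (x + h *\<^sub>R axis i 1)) has_real_derivative D) (at 0)"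
  shows "partially_differentiable i v x" "partial i v x = D"
  using assms unfolding partially_differentiable_def partial_def
  by (auto simp: real_differentiable_def intro: DERIV_imp_deriv)

lemma partial_add:
  assumes "partially_differentiable i u x" "partially_differentiable i v x"
  shows "partially_differentiable i (\<lambda>y. u y + v y) x"
    and "partial i (\<lambda>y. u y + v y) x = partial i u x + partial i v x"
  using partialI[of "\<lambda>y. u y + v y" x i, OF DERIV_add[OF assms[THEN partially_differentiable_has_derivative]]]
  by simp_all

lemma partial_mult:
  assumes "partially_differentiable i u x" "partially_differentiable i v x"
  shows "partially_differentiable i (\<lambda>y. u y * v y) x"
    and "partial i (\<lambda>y. u y * v y) x = partial i u x * v x + u x * partial i v x"
  using partialI[of "\<lambda>y. u y * v y" x i, OF DERIV_mult[OF assms[THEN partially_differentiable_has_derivative]]]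
  by (simp_all add: mult.commute)

text \<open>Near \<open>h = 0\<close> the line \<open>x + h e\<^sub>i\<close> stays inside the open set, so equality there is enough.\<close>

lemma eventually_eq_along_axis:
  fixes x :: "real^'d"
  assumes "open U" "x \<in> U" "\<And>y. y \<in> U \<Longrightarrow> u y = v y"
  shows "\<forall>\<^sub>F h in nhds (0::real). u (x + h *\<^sub>R axis i 1) = v (x + h *\<^sub>R axis i 1)"
proof -
  have "((\<lambda>h::real. x + h *\<^sub>R axis i 1) \<longlongrightarrow> x + 0 *\<^sub>R axis i 1) (nhds 0)"
    by (intro tendsto_intros filterlim_ident)
  then have "\<forall>\<^sub>F h in nhds (0::real). x + h *\<^sub>R axis i 1 \<in> U"
    using assms(1,2) by (auto simp: tendsto_def)
  then show ?thesis
    by eventually_elim (use assms(3) in auto)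
qed

lemma partial_cong:
  assumes "open U" "x \<in> U" "\<And>y. y \<in> U \<Longrightarrow> u y = v y"
  shows "partial i u x = partial i v x"
  unfolding partial_def by (rule deriv_cong_ev[OF eventually_eq_along_axis[of U x u v i, OF assms] refl])

lemma partially_differentiable_cong:
  assumes "open U" "x \<in> U" "\<And>y. y \<in> U \<Longrightarrow> u y = v y"
  shows "partially_differentiable i u x \<longleftrightarrow> partially_differentiable i v x"
  using DERIV_cong_ev[OF refl eventually_eq_along_axis[of U x u v i, OF assms] refl]
  unfolding partially_differentiable_def real_differentiable_def by blast

section \<open>Functions of class \<open>C\<^sup>k\<close>\<close>

lemma Ck_on_Suc_imp: "Ck_on (Suc k) U v \<Longrightarrow> Ck_on k U v"
  by (induction k arbitrary: v) auto

lemma Ck_on_cong: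
  assumes "open U" "\<And>y. y \<in> U \<Longrightarrow> u y = v y"
  shows "Ck_on k U u \<longleftrightarrow> Ck_on k U v"
  using assms(2)
proof (induction k arbitrary: u v)
  case 0
  then show ?case by (simp cong: continuous_on_cong)
next
  case (Suc k)
  have "Ck_on k U (partial i u) \<longleftrightarrow> Ck_on k U (partial i v)" for i
    by (rule Suc.IH) (use partial_cong[OF assms(1) _ Suc.prems] in auto)
  moreover have "continuous_on U u \<longleftrightarrow> continuous_on U v"
    using Suc.prems by (simp cong: continuous_on_cong)
  ultimately show ?case
    using partially_differentiable_cong[OF assms(1) _ Suc.prems] by auto
qed

lemma Ck_on_add:
  assumes "open U" "Ck_on k U u" "Ck_on k U v"
  shows "Ck_on k U (\<lambda>y. u y + v y)"
  using assms(2,3)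
proof (induction k arbitrary: u v)
  case 0
  then show ?case by (simp add: continuous_on_add)
next
  case (Suc k)
  have "Ck_on k U (partial i (\<lambda>y. u y + v y))" for i
  proof -
    have "Ck_on k U (\<lambda>y. partial i u y + partial i v y)"
      by (rule Suc.IH) (use Suc.prems in auto)
    then show ?thesis
      by (rule Ck_on_cong[OF assms(1), THEN iffD1, rotated]) (use Suc.prems in \<open>simp add: partial_add\<close>)
  qed
  with Suc.prems show ?case by (simp add: continuous_on_add partial_add)
qed

text \<open>
  Needed for the entries of \<open>q \<Sigma>\<close>, to which the Leibniz rule for second partial derivatives is
  applied with \<open>u\<close> as the other factor. The induction differentiates a product into a sum of
  products, hence the closure under addition above.
\<close>

lemma Ck_on_mult:
  assumes "open U" "Ck_on k U u" "Ck_on k U v"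
  shows "Ck_on k U (\<lambda>y. u y * v y)"
  using assms(2,3)
proof (induction k arbitrary: u v)
  case 0
  then show ?case by (simp add: continuous_on_mult)
next
  case (Suc k)
  have "Ck_on k U (partial i (\<lambda>y. u y * v y))" for i
  proof -
    have "Ck_on k U (\<lambda>y. partial i u y * v y + u y * partial i v y)"
      by (intro Ck_on_add Suc.IH assms(1); use Suc.prems Ck_on_Suc_imp in auto)
    then show ?thesis
      by (rule Ck_on_cong[OF assms(1), THEN iffD1, rotated]) (use Suc.prems in \<open>simp add: partial_mult\<close>)
  qed
  with Suc.prems show ?case by (simp add: continuous_on_mult partial_mult)
qed

lemma Ck_on_1_partially_differentiable:
  "Ck_on 1 U v \<Longrightarrow> x \<in> U \<Longrightarrow> partially_differentiable i v x"
  by simp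

lemma Ck_on_2_partially_differentiable:
  assumes "Ck_on 2 U v" "x \<in> U"
  shows "partially_differentiable i v x" "partially_differentiable i (partial j v) x"
  using assms by (auto simp: numeral_2_eq_2)

lemma partial_partial_mult:
  assumes "open U" "x \<in> U" "Ck_on 2 U u" "Ck_on 2 U v"
  shows "partial i (partial j (\<lambda>y. u y * v y)) x =
    partial i (partial j u) x * v x + partial j u x * partial i v x
      + partial i u x * partial j v x + u x * partial i (partial j v) x"
proof -
  note D = Ck_on_2_partially_differentiable
  have "partial i (partial j (\<lambda>y. u y * v y)) x =
      partial i (\<lambda>y. partial j u y * v y + u y * partial j v y) x"
    by (rule partial_cong[OF assms(1,2)]) (simp add: partial_mult D[OF assms(3)] D[OF assms(4)])
  also have "\<dots> = partial i (partial j u) x * v x + partial j u x * partial i v x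
      + partial i u x * partial j v x + u x * partial i (partial j v) x"
    using assms(2) by (simp add: partial_add partial_mult D[OF assms(3)] D[OF assms(4)])
  finally show ?thesis .
qed

section \<open>A Leibniz rule for the Fokker--Planck operator\<close>

lemma diffusion_matrix_symmetric: "diffusion_matrix \<sigma> x $ i $ j = diffusion_matrix \<sigma> x $ j $ i"
  by (simp add: diffusion_matrix_def matrix_matrix_mult_def transpose_def mult.commute)

lemma fokker_planck_cong:
  assumes "open U" "x \<in> U" "\<And>y. y \<in> U \<Longrightarrow> u y = v y"
  shows "fokker_planck b \<sigma> u x = fokker_planck b \<sigma> v x"
proof -
  have first: "partial i (\<lambda>y. u y * w y) z = partial i (\<lambda>y. v y * w y) z" if "z \<in> U" for i w z
    by (rule partial_cong[OF assms(1) that]) (simp add: assms(3))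
  have second: "partial i (partial j (\<lambda>y. u y * w y)) x = partial i (partial j (\<lambda>y. v y * w y)) x"
    for i j w
    by (rule partial_cong[OF assms(1,2)]) (rule first)
  show ?thesis
    by (simp add: fokker_planck_def divergence_def double_divergence_def first[OF assms(2)] second)
qed

lemma divergence_mult:
  assumes "\<And>i. partially_differentiable i u x"
    and "\<And>i. partially_differentiable i (\<lambda>y. F y $ i) x"
  shows "divergence (\<lambda>y. u y *\<^sub>R F y) x = u x * divergence F x + grad u x \<bullet> F x"
  using assms
  by (simp add: divergence_def grad_def inner_vec_def partial_mult sum.distrib sum_distrib_left)

text \<open>
  The two mixed terms \<open>\<partial>\<^sub>i u \<partial>\<^sub>j A\<^sub>i\<^sub>j\<close> and \<open>\<partial>\<^sub>j u \<partial>\<^sub>i A\<^sub>i\<^sub>j\<close> pair the gradient with the row-wise and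
  the column-wise divergence; for symmetric \<open>A\<close> these agree after renaming indices, whence the
  factor 2.
\<close>

lemma double_divergence_mult:
  assumes "open U" "x \<in> U" "Ck_on 2 U u"
    and C2: "\<And>i j. Ck_on 2 U (\<lambda>y. A y $ i $ j)"
    and sym: "\<And>y i j. A y $ i $ j = A y $ j $ i"
  shows "double_divergence (\<lambda>y. u y *\<^sub>R A y) x =
    u x * double_divergence A x + 2 * (grad u x \<bullet> mat_divergence A x)
      + frobenius (A x) (hessian u x)"
proof -
  define a where "a i j = (\<lambda>y. A y $ i $ j)" for i j
  have a_sym: "a i j = a j i" for i j
    using sym by (auto simp: a_def)
  have rows: "(\<Sum>i\<in>UNIV. \<Sum>j\<in>UNIV. partial i u x * partial j (a i j) x)
      = grad u x \<bullet> mat_divergence A x"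
    by (simp add: grad_def mat_divergence_def inner_vec_def a_def sum_distrib_left)
  have "(\<Sum>i\<in>UNIV. \<Sum>j\<in>UNIV. partial j u x * partial i (a i j) x)
      = (\<Sum>j\<in>UNIV. \<Sum>i\<in>UNIV. partial j u x * partial i (a j i) x)"
    by (subst sum.swap) (simp add: a_sym)
  also have "\<dots> = grad u x \<bullet> mat_divergence A x"
    by (rule rows)
  finally have columns: "(\<Sum>i\<in>UNIV. \<Sum>j\<in>UNIV. partial j u x * partial i (a i j) x)
      = grad u x \<bullet> mat_divergence A x" .
  have "double_divergence (\<lambda>y. u y *\<^sub>R A y) x =
      (\<Sum>i\<in>UNIV. \<Sum>j\<in>UNIV. partial i (partial j u) x * a i j x
        + partial j u x * partial i (a i j) x + partial i u x * partial j (a i j) x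
        + u x * partial i (partial j (a i j)) x)"
    using partial_partial_mult[OF assms(1-3) C2] by (simp add: double_divergence_def a_def)
  also have "\<dots> = (\<Sum>i\<in>UNIV. \<Sum>j\<in>UNIV. partial i (partial j u) x * a i j x)
      + (\<Sum>i\<in>UNIV. \<Sum>j\<in>UNIV. partial j u x * partial i (a i j) x)
      + (\<Sum>i\<in>UNIV. \<Sum>j\<in>UNIV. partial i u x * partial j (a i j) x)
      + u x * (\<Sum>i\<in>UNIV. \<Sum>j\<in>UNIV. partial i (partial j (a i j)) x)"
    by (simp add: sum.distrib sum_distrib_left)
  also have "\<dots> = frobenius (A x) (hessian u x) + 2 * (grad u x \<bullet> mat_divergence A x)
      + u x * double_divergence A x"
    unfolding rows columns
    by (simp add: frobenius_def hessian_def double_divergence_def a_def mult.commute)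
  finally show ?thesis by simp
qed

text \<open>
  The terms are grouped so that the defect from \<open>L\<^sup>*(u q) = u L\<^sup>* q + q L u\<close> is a multiple of the
  probability flux of \<open>q\<close>, the quantity that detailed balance makes vanish.
\<close>

lemma fokker_planck_mult:
  assumes "open U" "x \<in> U"
    and b: "\<And>i. Ck_on 1 U (\<lambda>y. b y $ i)"
    and \<Sigma>: "\<And>i j. Ck_on 2 U (\<lambda>y. diffusion_matrix \<sigma> y $ i $ j)"
    and q: "Ck_on 2 U q"
    and u: "Ck_on 2 U u"
  shows "fokker_planck b \<sigma> (\<lambda>y. u y * q y) x =
    u x * fokker_planck b \<sigma> q x + q x * generator b \<sigma> u x
      - 2 * (grad u x \<bullet>
          (q x *\<^sub>R b x - (1/2) *\<^sub>R mat_divergence (\<lambda>y. q y *\<^sub>R diffusion_matrix \<sigma> y) x))"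
proof -
  let ?A = "\<lambda>y. q y *\<^sub>R diffusion_matrix \<sigma> y"
  have first_order: "divergence (\<lambda>y. u y *\<^sub>R (q y *\<^sub>R b y)) x
      = u x * divergence (\<lambda>y. q y *\<^sub>R b y) x + grad u x \<bullet> (q x *\<^sub>R b x)"
    using Ck_on_2_partially_differentiable(1)[OF u assms(2)]
      Ck_on_2_partially_differentiable(1)[OF q assms(2)]
      Ck_on_1_partially_differentiable[OF b assms(2)]
    by (intro divergence_mult) (simp_all add: partial_mult)
  have second_order: "double_divergence (\<lambda>y. u y *\<^sub>R ?A y) x
      = u x * double_divergence ?A x + 2 * (grad u x \<bullet> mat_divergence ?A x)
        + frobenius (?A x) (hessian u x)"
  proof (rule double_divergence_mult[OF assms(1,2) u])
    show "Ck_on 2 U (\<lambda>y. ?A y $ i $ j)" for i j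
      using Ck_on_mult[OF assms(1) q \<Sigma>] by simp
    show "?A y $ i $ j = ?A y $ j $ i" for y i j
      using diffusion_matrix_symmetric[of \<sigma> y i j] by simp
  qed
  have "frobenius (?A x) (hessian u x) = q x * frobenius (diffusion_matrix \<sigma> x) (hessian u x)"
    by (simp add: frobenius_def sum_distrib_left mult.assoc)
  with first_order second_order show ?thesis
    by (simp add: fokker_planck_def generator_def inner_diff_right inner_commute algebra_simps)
qed

theorem proposition3p1:
  fixes M U :: "(real^'d) set"
    and T :: "real set"
    and b :: "real^'d \<Rightarrow> real^'d"
    and \<sigma> :: "real^'d \<Rightarrow> real^'s^'d"
    and p\<^sub>s :: "real^'d \<Rightarrow> real"
    and f p :: "real^'d \<Rightarrow> real \<Rightarrow> real"
  assumes "open U" and "M \<subseteq> U"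
    and "\<And>i. Ck_on 1 U (\<lambda>x. b x $ i)"
    and "\<And>i j. Ck_on 2 U (\<lambda>x. diffusion_matrix \<sigma> x $ i $ j)"
    and "Ck_on 2 U p\<^sub>s"
    and "\<And>t. t \<in> T \<Longrightarrow> Ck_on 2 U (\<lambda>x. f x t)"
    and "stationary_density M b \<sigma> p\<^sub>s"
    and zero_flux: "\<And>x. x \<in> M \<Longrightarrow>
          p\<^sub>s x *\<^sub>R b x = (1/2) *\<^sub>R mat_divergence (\<lambda>y. p\<^sub>s y *\<^sub>R diffusion_matrix \<sigma> y) x"
    and "\<And>t. t \<in> T \<Longrightarrow> (\<lambda>x. p x t) \<in> fokker_planck_domain U b \<sigma>"
    and "\<And>x t. x \<in> U \<Longrightarrow> t \<in> T \<Longrightarrow> p x t = f x t * p\<^sub>s x"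
  shows "\<forall>t\<in>T. \<forall>x\<in>M.
    fokker_planck b \<sigma> (\<lambda>y. p y t) x = p\<^sub>s x * generator b \<sigma> (\<lambda>y. f y t) x"
proof (intro ballI)
  fix t x
  assume t: "t \<in> T" and x: "x \<in> M"
  from x \<open>M \<subseteq> U\<close> have "x \<in> U" by auto
  have "fokker_planck b \<sigma> (\<lambda>y. p y t) x = fokker_planck b \<sigma> (\<lambda>y. f y t * p\<^sub>s y) x"
    by (rule fokker_planck_cong[OF assms(1) \<open>x \<in> U\<close>]) (simp add: assms(10) t)
  also have "\<dots> = f x t * fokker_planck b \<sigma> p\<^sub>s x + p\<^sub>s x * generator b \<sigma> (\<lambda>y. f y t) x"
    using fokker_planck_mult[OF assms(1) \<open>x \<in> U\<close> assms(3-5) assms(6)[OF t]] zero_flux[OF x]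
    by simp
  also have "\<dots> = p\<^sub>s x * generator b \<sigma> (\<lambda>y. f y t) x"
    using assms(7) x by (simp add: stationary_density_def)
  finally show "fokker_planck b \<sigma> (\<lambda>y. p y t) x = p\<^sub>s x * generator b \<sigma> (\<lambda>y. f y t) x" .
qed

end
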